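(* Suppose that each of the $n$ devices has a unique identifier in $[N]$, and that the size $N$ of the ID space and an estimate $\tilde{n}$ of the number of devices $n$ with $\tilde{n}/2 < n \leq \tilde{n}$ are both known to all devices. Then there is a deterministic leader election algorithm in the $\mathsf{No}\text{-}\mathsf{CD}$ model with time complexity $O\left(n \log \frac{N}{n}\right)$ and energy complexity $O\left(\log \frac{N}{n}\right)$.
   Context: Model: $n$ devices are connected to a multiple-access channel. Communication proceeds in synchronous rounds with a common time zero; in each round each device either transmits a message, listens to the channel, or stays idle. In the $\mathsf{No}\text{-}\mathsf{CD}$ model, transmitters receive no feedback, and a listener receives the message $m$ if exactly one device transmits in that round, and otherwise (zero or at least two transmitters) receives silence. Leader election: exactly one device must identify itself as the leader and all others as non-leaders; the protocol ends when the leader sends a message while every non-leader listens, so all devices terminate in the same round. Time complexity is the number of rounds (worst case); the energy cost of a device is its number of non-idle (transmitting or listening) rounds, and the energy complexity is the maximum energy cost over all devices (worst case).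
   Formalization: The factor log(N/n) in both bounds is read as 1 + log₂(N/n), since log(N/n) vanishes at n = N, although every execution takes at least one round and costs the leader at least one unit of energy; for N ≥ 2n the two agree up to a constant factor. *)

theory Defs
  imports Complex_Main
begin

text \<open>
  The multiple-access channel without collision detection (No-CD).  Message size is unbounded;
  since messages are finite objects they are represented by natural numbers.
\<close>

type_synonym message = nat

datatype action = Transmit message | Listen | Idle

datatype feedback = Received message | Silence | No_Feedback

datatype verdict = Leader | Non_Leader

text \<open>
  A deterministic device.  Both functions take the list of feedbacks obtained in the rounds
  performed so far, which together with the device's program determines its own past actions.
  The function \<open>act\<close> yields the action in the next round; \<open>verdict_of\<close> is \<open>None\<close> as long as the
  device has not terminated, and its output once it has.
\<close>

datatype device =
  Device (act: "feedback list \<Rightarrow> action") (verdict_of: "feedback list \<Rightarrow> verdict option")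

text \<open>
  The program of a device depends on the size of the ID space, the estimate of the number of
  devices and the device's own ID, in this order, and on nothing else.
\<close>

type_synonym algorithm = "nat \<Rightarrow> real \<Rightarrow> nat \<Rightarrow> device"

text \<open>
  Devices are identified with their IDs: \<open>S\<close> is the set of devices present and \<open>a u\<close> is the action
  of device \<open>u\<close> in the round under consideration.
\<close>

definition no_cd_feedback :: "nat set \<Rightarrow> (nat \<Rightarrow> action) \<Rightarrow> nat \<Rightarrow> feedback" where
  "no_cd_feedback S a v =
     (case a v of
        Listen \<Rightarrow>
          if \<exists>!u. u \<in> S \<and> (\<exists>m. a u = Transmit m)
          then Received (THE m. \<exists>u\<in>S. a u = Transmit m)
          else Silence
      | _ \<Rightarrow> No_Feedback)"

text \<open>
  \<open>history P S t v\<close> is the feedback seen by device \<open>v\<close> in the first \<open>t\<close> rounds when device \<open>u\<close>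
  runs program \<open>P u\<close>.  Rounds are numbered from 0, so that \<open>action_in P S t v\<close> is the action
  of \<open>v\<close> after \<open>t\<close> completed rounds.
\<close>

primrec history :: "(nat \<Rightarrow> device) \<Rightarrow> nat set \<Rightarrow> nat \<Rightarrow> nat \<Rightarrow> feedback list" where
  "history P S 0 v = []"
| "history P S (Suc t) v =
     history P S t v @ [no_cd_feedback S (\<lambda>u. act (P u) (history P S t u)) v]"

definition action_in :: "(nat \<Rightarrow> device) \<Rightarrow> nat set \<Rightarrow> nat \<Rightarrow> nat \<Rightarrow> action" where
  "action_in P S t v = act (P v) (history P S t v)"

definition verdict_after :: "(nat \<Rightarrow> device) \<Rightarrow> nat set \<Rightarrow> nat \<Rightarrow> nat \<Rightarrow> verdict option" where
  "verdict_after P S t v = verdict_of (P v) (history P S t v)"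

text \<open>
  The execution lasts exactly \<open>T\<close> rounds and elects a leader: no device terminates earlier, all
  terminate after \<open>T\<close> rounds, and in the last round (number \<open>T - 1\<close>) the leader transmits while all
  other devices listen.
\<close>

definition elects_leader :: "(nat \<Rightarrow> device) \<Rightarrow> nat set \<Rightarrow> nat \<Rightarrow> bool" where
  "elects_leader P S T \<longleftrightarrow>
     T > 0 \<and>
     (\<forall>v\<in>S. \<forall>t<T. verdict_after P S t v = None) \<and>
     (\<exists>l\<in>S. verdict_after P S T l = Some Leader \<and>
            (\<exists>m. action_in P S (T - 1) l = Transmit m) \<and>
            (\<forall>v\<in>S - {l}. verdict_after P S T v = Some Non_Leader \<and>
                          action_in P S (T - 1) v = Listen))"

definition energy :: "(nat \<Rightarrow> device) \<Rightarrow> nat set \<Rightarrow> nat \<Rightarrow> nat \<Rightarrow> nat" where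
  "energy P S T v = card {t. t < T \<and> action_in P S t v \<noteq> Idle}"

text \<open>
  The factor \<open>log (N/n)\<close> inside asymptotic bounds, where it is understood to be at least a positive
  constant: it would vanish for \<open>n = N\<close>, although every execution takes at least one round and
  costs the leader at least one unit of energy.
\<close>

definition log_ratio :: "nat \<Rightarrow> nat \<Rightarrow> real" where
  "log_ratio N n = 1 + log 2 (real N / real n)"

end

(*
  Let the tests be a sequence of pairs (A, B) of disjoint sets of IDs.  A device u passes a test if
  it is the only device present in A and B contains exactly one device present: then it is heard
  by the latter, which can confirm this.  Drawing random maps from the IDs to O(n) slots, grouped
  into bins, and testing pairs of slots of a common bin, O(log(N/n)) maps suffice for a constant
  fraction of every possible set of devices to pass some test, and each device takes part in only
  O(log(N/n)) of the O(n log(N/n)) tests.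

  The devices that pass a test join a first-in first-out queue, the position of the test serving as
  time of arrival.  Every newcomer is granted a service period of c = O(log(N/n)) positions, which
  starts when all periods granted before are over; whoever is serving listens for newcomers and
  tells them the starting time.  A device can thus sleep until its own period begins.  As the
  granted periods are disjoint and their total length exceeds the number of tests, exactly one
  device serves when the tests are over, and this device is the leader.
*)

theory Submission
  imports Defs "HOL-Library.FuncSet"
begin

section \<open>Separating tests\<close>

text \<open>Fix \<open>f\<close> outside \<open>D\<close> first. Each element of \<open>D\<close>
  must then repeat a value taken on \<open>S - D\<close>, which leaves it at most
  \<open>card S\<close> choices.\<close>

lemma card_maps_into_rest_le:
  assumes "finite X" "S \<subseteq> X" "D \<subseteq> S" "finite Y"
  shows "card {f \<in> X \<rightarrow>\<^sub>E Y. f ` D \<subseteq> f ` (S - D)}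
           \<le> card Y ^ (card X - card D) * card S ^ card D"
proof -
  let ?F = "{f \<in> X \<rightarrow>\<^sub>E Y. f ` D \<subseteq> f ` (S - D)}"
  let ?G = "SIGMA g : (X - D) \<rightarrow>\<^sub>E Y. D \<rightarrow>\<^sub>E g ` (S - D)"
  let ?r = "\<lambda>f. (restrict f (X - D), restrict f D)"
  have fin: "finite D" "finite (X - D)" "finite S"
    using assms by (auto intro: finite_subset)
  have inj: "inj_on ?r ?F"
  proof (rule inj_onI)
    fix f g assume fg: "f \<in> ?F" "g \<in> ?F" "?r f = ?r g"
    show "f = g"
    proof
      fix x
      have "restrict f (X - D) x = restrict g (X - D) x" "restrict f D x = restrict g D x"
        using fg(3) by (metis prod.inject)+
      then show "f x = g x"
        using fg(1,2) by (cases "x \<in> X"; cases "x \<in> D")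
          (auto simp: restrict_def PiE_def extensional_def split: if_splits)
    qed
  qed
  have "?r ` ?F \<subseteq> ?G"
    using assms(2,3) by (fastforce simp: PiE_def Pi_def image_subset_iff)
  moreover have "finite ?G"
    using fin assms(4) by (intro finite_SigmaI finite_PiE) auto
  ultimately have "card ?F \<le> card ?G"
    by (rule card_inj_on_le[OF inj])
  also have "card ?G = (\<Sum>g\<in>(X - D) \<rightarrow>\<^sub>E Y. card (g ` (S - D)) ^ card D)"
    using fin assms(4) by (subst card_SigmaI) (auto intro!: finite_PiE simp: card_PiE)
  also have "\<dots> \<le> (\<Sum>g\<in>(X - D) \<rightarrow>\<^sub>E Y. card S ^ card D)"
  proof (rule sum_mono)
    fix g
    have "card (g ` (S - D)) \<le> card S"
      by (meson Diff_subset card_image_le card_mono fin(3) finite_Diff le_trans)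
    then show "card (g ` (S - D)) ^ card D \<le> card S ^ card D"
      by (rule power_mono) simp
  qed
  also have "\<dots> = card Y ^ (card X - card D) * card S ^ card D"
    using fin assms by (simp add: card_PiE card_Diff_subset)
  finally show ?thesis .
qed

text \<open>Union bound with \<open>k = card S\<close>. If \<open>f\<close> takes few values on
  \<open>S\<close>, removing one preimage of each value leaves a set \<open>D\<close> with
  \<open>k \<le> 8 * card D\<close> whose values all recur on \<open>S - D\<close>. For fixed
  \<open>D\<close> this has probability at most \<open>(k / m) ^ card D\<close>, hence at most
  \<open>2 ^ -(3 * k)\<close>, and there are at most \<open>2 ^ k\<close> choices of
  \<open>D\<close>.\<close>

lemma card_few_values_maps_le:
  fixes m :: nat
  assumes X: "finite X" "S \<subseteq> X" and m: "2 ^ 24 * card S \<le> m"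
  shows "2 ^ (2 * card S) * card {f \<in> X \<rightarrow>\<^sub>E {..<m}. 8 * card (f ` S) < 7 * card S}
           \<le> m ^ card X"
proof -
  let ?k = "card S"
  let ?M = "X \<rightarrow>\<^sub>E {..<m}"
  let ?bad = "{f \<in> ?M. 8 * card (f ` S) < 7 * ?k}"
  let ?\<D> = "{D. D \<subseteq> S \<and> ?k \<le> 8 * card D}"
  let ?B = "\<lambda>D. {f \<in> ?M. f ` D \<subseteq> f ` (S - D)}"
  have finS: "finite S" using X by (auto intro: finite_subset)
  have finM: "finite ?M" using X by (auto intro: finite_PiE)
  have fin\<D>: "finite ?\<D>" using finS by (auto intro: finite_subset[of _ "Pow S"])
  have sub: "?bad \<subseteq> (\<Union>D\<in>?\<D>. ?B D)"
  proof
    fix f assume f: "f \<in> ?bad"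
    obtain Q where Q: "Q \<subseteq> S" "inj_on f Q" "f ` S = f ` Q"
      using subset_image_inj[of "f ` S" f S] by auto
    have "card (f ` S) = card Q" using Q by (simp add: card_image)
    moreover have "card (S - Q) = ?k - card Q"
      using Q(1) finS by (meson card_Diff_subset finite_subset)
    ultimately have "?k \<le> 8 * card (S - Q)" using f by auto
    moreover have "f ` (S - Q) \<subseteq> f ` (S - (S - Q))"
      using Q by (auto simp: double_diff)
    ultimately show "f \<in> (\<Union>D\<in>?\<D>. ?B D)" using f by blast
  qed
  have each: "2 ^ (3 * ?k) * card (?B D) \<le> m ^ card X" if D: "D \<in> ?\<D>" for D
  proof -
    have Dle: "card D \<le> card X"
      using D X by (auto intro: card_mono)
    have "(2::nat) ^ (3 * ?k) \<le> 2 ^ (24 * card D)"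
      using D by (intro power_increasing) auto
    then have "2 ^ (3 * ?k) * card (?B D)
        \<le> 2 ^ (24 * card D) * (m ^ (card X - card D) * ?k ^ card D)"
      using card_maps_into_rest_le[of X S D "{..<m}"] D X by (intro mult_mono) auto
    also have "\<dots> = m ^ (card X - card D) * (2 ^ 24 * ?k) ^ card D"
      by (simp add: power_mult power_mult_distrib)
    also have "\<dots> \<le> m ^ (card X - card D) * m ^ card D"
      using m by (intro mult_left_mono power_mono) auto
    also have "\<dots> = m ^ card X"
      using Dle by (simp flip: power_add)
    finally show ?thesis .
  qed
  have "card ?bad \<le> card (\<Union>D\<in>?\<D>. ?B D)"
    using finM fin\<D> by (intro card_mono[OF _ sub]) auto
  also have "\<dots> \<le> (\<Sum>D\<in>?\<D>. card (?B D))"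
    using fin\<D> by (rule card_UN_le)
  finally have "2 ^ (3 * ?k) * card ?bad \<le> (\<Sum>D\<in>?\<D>. 2 ^ (3 * ?k) * card (?B D))"
    by (simp flip: sum_distrib_left)
  also have "\<dots> \<le> card ?\<D> * m ^ card X"
    using sum_bounded_above[of ?\<D> "\<lambda>D. 2 ^ (3 * ?k) * card (?B D)" "m ^ card X"] each by simp
  also have "\<dots> \<le> 2 ^ ?k * m ^ card X"
    using card_mono[of "Pow S" ?\<D>] finS by (intro mult_right_mono) (auto simp: card_Pow)
  finally have "2 ^ ?k * (2 ^ (2 * ?k) * card ?bad) \<le> 2 ^ ?k * m ^ card X"
    using power_add[of "2::nat" ?k "2 * ?k"] by (simp add: mult.assoc)
  then show ?thesis by simp
qed

text \<open>Averaging over all maps: each member of \<open>\<B>\<close> is bad for at most a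
  fraction \<open>2 ^ -K\<close> of them, so some map is bad for at most that fraction of
  \<open>\<B>\<close>.\<close>

lemma ex_map_few_failures:
  fixes m K :: nat
  assumes X: "finite X" and m: "0 < m"
    and \<B>: "\<And>S. S \<in> \<B> \<Longrightarrow> S \<subseteq> X \<and> K \<le> 2 * card S \<and> 2 ^ 24 * card S \<le> m"
  shows "\<exists>f\<in>X \<rightarrow>\<^sub>E {..<m}. 2 ^ K * card {S \<in> \<B>. 8 * card (f ` S) < 7 * card S} \<le> card \<B>"
proof (rule ccontr)
  let ?M = "X \<rightarrow>\<^sub>E {..<m}"
  let ?bad = "\<lambda>f S. 8 * card (f ` S) < 7 * card S"
  assume "\<not> ?thesis"
  then have less: "card \<B> < 2 ^ K * card {S \<in> \<B>. ?bad f S}" if "f \<in> ?M" for f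
    using that by (meson not_le)
  have finM: "finite ?M" using X by (auto intro: finite_PiE)
  have fin: "finite \<B>"
    using X \<B> by (auto intro: finite_subset[of _ "Pow X"])
  have cardM: "card ?M = m ^ card X" using X by (simp add: card_PiE)
  have "?M \<noteq> {}" using m by (auto simp: PiE_eq_empty_iff)
  then have "card ?M * card \<B> < (\<Sum>f\<in>?M. 2 ^ K * card {S \<in> \<B>. ?bad f S})"
    using sum_strict_mono[OF finM, of "\<lambda>_. card \<B>"] less by simp
  also have "\<dots> = 2 ^ K * (\<Sum>S\<in>\<B>. card {f \<in> ?M. ?bad f S})"
    using sum_multicount_gen[OF finM fin, of "\<lambda>f S. ?bad f S" "\<lambda>S. card {f \<in> ?M. ?bad f S}"]
    by (simp add: sum_distrib_left[symmetric])
  also have "\<dots> = (\<Sum>S\<in>\<B>. 2 ^ K * card {f \<in> ?M. ?bad f S})"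
    by (rule sum_distrib_left)
  also have "\<dots> \<le> (\<Sum>S\<in>\<B>. m ^ card X)"
  proof (rule sum_mono)
    fix S assume S: "S \<in> \<B>"
    have "2 ^ K * card {f \<in> ?M. ?bad f S} \<le> 2 ^ (2 * card S) * card {f \<in> ?M. ?bad f S}"
      using \<B>[OF S] by (intro mult_right_mono power_increasing) auto
    also have "\<dots> \<le> m ^ card X"
      using \<B>[OF S] X by (intro card_few_values_maps_le) auto
    finally show "2 ^ K * card {f \<in> ?M. ?bad f S} \<le> m ^ card X" .
  qed
  finally show False using cardM by simp
qed

text \<open>Greedy choice: each new map is chosen for the sets on which all earlier ones fail, so it
  divides the number of failures by at least \<open>2 ^ K\<close>.\<close>

lemma ex_maps_few_failures:
  fixes m K :: nat
  assumes X: "finite X" and m: "0 < m"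
    and \<B>: "\<And>S. S \<in> \<B> \<Longrightarrow> S \<subseteq> X \<and> K \<le> 2 * card S \<and> 2 ^ 24 * card S \<le> m"
  shows "\<exists>fs. length fs = d \<and> set fs \<subseteq> X \<rightarrow>\<^sub>E {..<m} \<and>
     2 ^ (K * d) * card {S \<in> \<B>. \<forall>f\<in>set fs. 8 * card (f ` S) < 7 * card S} \<le> card \<B>"
proof (induction d)
  case 0
  show ?case by (intro exI[of _ "[]"]) simp
next
  case (Suc d)
  then obtain fs where fs: "length fs = d" "set fs \<subseteq> X \<rightarrow>\<^sub>E {..<m}"
    "2 ^ (K * d) * card {S \<in> \<B>. \<forall>f\<in>set fs. 8 * card (f ` S) < 7 * card S} \<le> card \<B>"
    by blast
  let ?\<B> = "{S \<in> \<B>. \<forall>f\<in>set fs. 8 * card (f ` S) < 7 * card S}"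
  obtain f where f: "f \<in> X \<rightarrow>\<^sub>E {..<m}"
    "2 ^ K * card {S \<in> ?\<B>. 8 * card (f ` S) < 7 * card S} \<le> card ?\<B>"
    using ex_map_few_failures[OF X m, of ?\<B> K] \<B> by blast
  have eq: "{S \<in> ?\<B>. 8 * card (f ` S) < 7 * card S}
      = {S \<in> \<B>. \<forall>f\<in>set (f # fs). 8 * card (f ` S) < 7 * card S}" by auto
  have "2 ^ (K * Suc d) * card {S \<in> ?\<B>. 8 * card (f ` S) < 7 * card S}
      = 2 ^ (K * d) * (2 ^ K * card {S \<in> ?\<B>. 8 * card (f ` S) < 7 * card S})"
    by (simp add: power_add)
  also have "\<dots> \<le> 2 ^ (K * d) * card ?\<B>" using f(2) by (rule mult_left_mono) simp
  also have "\<dots> \<le> card \<B>" by (rule fs(3))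
  finally show ?case
    unfolding eq using fs(1,2) f(1) by (intro exI[of _ "f # fs"]) auto
qed

section \<open>Counting small subsets\<close>

lemma sum_power_card_Pow:
  fixes y :: "'b :: comm_semiring_1"
  assumes "finite X"
  shows "(\<Sum>S\<in>Pow X. y ^ card S) = (1 + y) ^ card X"
  using assms
proof (induction X rule: finite_induct)
  case (insert x X)
  have "(\<Sum>S\<in>insert x ` Pow X. y ^ card S) = (\<Sum>S\<in>Pow X. y ^ card (insert x S))"
    using insert by (subst sum.reindex) (auto simp: inj_on_def)
  also have "\<dots> = y * (\<Sum>S\<in>Pow X. y ^ card S)"
    unfolding sum_distrib_left
    using insert by (intro sum.cong) (auto simp: card_insert_if finite_subset)
  finally show ?case
    unfolding Pow_insert using insert
    by (subst sum.union_disjoint) (auto simp: algebra_simps)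
qed simp

text \<open>Weigh each set by \<open>y ^ card S\<close> with \<open>y \<le> 1\<close>: every small
  set weighs at least \<open>y ^ K\<close>, while all subsets together weigh
  \<open>(1 + y) ^ N\<close>.\<close>

lemma card_small_subsets_le:
  fixes N K :: nat
  assumes X: "finite X" "card X = N" and K: "0 < K" "K \<le> 2 * N"
  shows "card {S. S \<subseteq> X \<and> card S \<le> K} * K ^ K \<le> (4 * N) ^ K"
proof -
  \<comment> \<open>This \<open>y\<close> is at most 1 because \<open>K \<le> 2 * N\<close>, and it
    bounds the total weight by \<open>exp (K / 2)\<close>, hence by \<open>2 ^ K\<close>.\<close>
  define y :: real where "y = K / (2 * N)"
  have y: "0 < y" "y \<le> 1" using K by (auto simp: y_def)
  let ?\<C> = "{S. S \<subseteq> X \<and> card S \<le> K}"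
  have "real (card ?\<C>) * y ^ K = (\<Sum>S\<in>?\<C>. y ^ K)" by simp
  also have "\<dots> \<le> (\<Sum>S\<in>?\<C>. y ^ card S)"
    using y by (intro sum_mono power_decreasing) auto
  also have "\<dots> \<le> (\<Sum>S\<in>Pow X. y ^ card S)"
    using X y by (intro sum_mono2) auto
  also have "\<dots> = (1 + y) ^ N" using X by (simp add: sum_power_card_Pow)
  also have "\<dots> \<le> exp y ^ N" using y by (intro power_mono) auto
  also have "\<dots> = exp (1/2) ^ K"
    using K by (simp add: y_def flip: exp_of_nat_mult)
  also have "\<dots> \<le> 2 ^ K"
  proof (rule power_mono)
    have "exp (1/2 :: real) \<le> 1 + 1/2 + (1/2)\<^sup>2" by (rule exp_bound) auto
    then show "exp (1/2 :: real) \<le> 2" by (simp add: power2_eq_square)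
  qed simp
  finally have "real (card ?\<C>) * K ^ K \<le> 2 ^ K * (2 * N) ^ K"
    using K by (simp add: y_def power_divide field_simps)
  then have "card ?\<C> * K ^ K \<le> 2 ^ K * (2 * N) ^ K"
    by (simp only: of_nat_le_iff flip: of_nat_mult)
  also have "\<dots> = (4 * N) ^ K"
    unfolding power_mult_distrib[symmetric] by simp
  finally show ?thesis .
qed

section \<open>From nearly injective maps to tests\<close>

text \<open>Read \<open>f\<close> as an assignment to slots and the residue mod \<open>b\<close> as
  the bin. A shared slot uses up at least two elements, so at least 3/4 of \<open>S\<close> are
  alone in their slots. At most one of these per bin lacks a partner there; this loses at most
  \<open>b\<close>, that is half of \<open>card S\<close>, and 1/4 remains.\<close>

lemma card_tested_ge:
  fixes f :: "'a \<Rightarrow> nat"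
  assumes S: "finite S" and f: "7 * card S \<le> 8 * card (f ` S)" and b: "0 < b" "2 * b \<le> card S"
  shows "card S \<le> 4 * card {u \<in> S. \<exists>w\<in>S. f w \<noteq> f u \<and> f w mod b = f u mod b \<and>
           {x \<in> S. f x = f u} = {u} \<and> {x \<in> S. f x = f w} = {w}}"
    (is "_ \<le> 4 * card ?V")
proof -
  define U where "U = {u \<in> S. {x \<in> S. f x = f u} = {u}}"
  have US: "U \<subseteq> S" and VU: "?V \<subseteq> U" by (auto simp: U_def)
  have fin: "finite U" "finite (S - U)" using S US by (auto intro: finite_subset)
  obtain Q where Q: "Q \<subseteq> S - U" "inj_on f Q" "f ` (S - U) = f ` Q"
    using subset_image_inj[of "f ` (S - U)" f "S - U"] by auto
  have "f ` Q \<subseteq> f ` (S - U - Q)"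
  proof
    fix y assume "y \<in> f ` Q"
    then obtain u where u: "u \<in> Q" "y = f u" by blast
    then have "u \<in> S" "{x \<in> S. f x = f u} \<noteq> {u}"
      using Q(1) by (auto simp: U_def)
    then obtain x where x: "x \<in> S" "f x = f u" "x \<noteq> u" by auto
    then have "x \<notin> U" using \<open>u \<in> S\<close> by (auto simp: U_def)
    moreover have "x \<notin> Q" using x u(1) Q(2) by (auto dest: inj_onD)
    ultimately show "y \<in> f ` (S - U - Q)"
      using x u(2) by (intro image_eqI[of _ _ x]) auto
  qed
  then have "card (f ` Q) \<le> card (S - U - Q)"
    using fin by (meson card_image_le card_mono finite_Diff finite_imageI le_trans)
  moreover have "card (S - U - Q) = card (S - U) - card Q"
    using Q(1) fin by (meson card_Diff_subset finite_subset)
  moreover have "card (S - U) = card S - card U" "card U \<le> card S"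
    using US S fin by (auto simp: card_Diff_subset card_mono)
  moreover have "card (f ` S) \<le> card (f ` U) + card (f ` (S - U))"
    by (metis Diff_partition US card_Un_le image_Un)
  moreover have "card (f ` U) \<le> card U" using fin by (intro card_image_le)
  moreover have "card (f ` Q) = card Q" using Q(2) by (rule card_image)
  ultimately have "2 * card (f ` S) \<le> card S + card U"
    using Q(3) by simp
  moreover have "card (U - ?V) \<le> card {..<b}"
  proof (rule card_inj_on_le[of "\<lambda>u. f u mod b"])
    show "inj_on (\<lambda>u. f u mod b) (U - ?V)"
    proof (rule inj_onI)
      fix u w assume *: "u \<in> U - ?V" "w \<in> U - ?V" "f u mod b = f w mod b"
      then have "f u = f w" by (auto simp: U_def)
      then show "u = w" using * by (auto simp: U_def)
    qed
  qed (use b in auto)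
  moreover have "card (U - ?V) = card U - card ?V"
    using VU fin by (meson card_Diff_subset finite_subset)
  ultimately show ?thesis using f b(2) by simp
qed

lemma card_residue_class_le:
  fixes b G c :: nat
  assumes "0 < b"
  shows "card {y. y < b * G \<and> y mod b = c} \<le> G"
proof -
  have "card {y. y < b * G \<and> y mod b = c} \<le> card {..<G}"
  proof (rule card_inj_on_le[of "\<lambda>y. y div b"])
    show "inj_on (\<lambda>y. y div b) {y. y < b * G \<and> y mod b = c}"
      by (rule inj_onI) (metis (mono_tags, lifting) div_mult_mod_eq mem_Collect_eq)
  qed (auto simp: less_mult_imp_div_less mult.commute)
  then show ?thesis by simp
qed

definition tested :: "(nat set \<times> nat set) list \<Rightarrow> nat set \<Rightarrow> nat \<Rightarrow> nat \<Rightarrow> bool" where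
  "tested ts S p u \<longleftrightarrow> fst (ts ! p) \<inter> S = {u} \<and> (\<exists>w. snd (ts ! p) \<inter> S = {w})"

text \<open>There are \<open>b\<close> bins of \<open>G\<close> slots each, and each of
  \<open>d\<close> maps contributes a test for every ordered pair of distinct slots of a common bin.
  A device takes part only if its own slot is one of the two, hence in at most \<open>2 * G\<close>
  tests per map.\<close>

lemma ex_tests:
  fixes N K d G :: nat
  assumes K: "2 \<le> K" "K \<le> 2 * N" and d: "4 * N < K * 2 ^ d" and G: "G = 2 ^ 27"
  shows "\<exists>ts. (\<forall>T\<in>set ts. fst T \<inter> snd T = {}) \<and> length ts \<le> d * K * G\<^sup>2 \<and>
    (\<forall>v. card {p. p < length ts \<and> v \<in> fst (ts ! p) \<union> snd (ts ! p)} \<le> 2 * d * G) \<and>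
    (\<forall>S. S \<subseteq> {1..N} \<and> card S \<le> K \<and> K < 2 * card S \<longrightarrow>
       K \<le> 8 * card {u \<in> S. \<exists>p<length ts. tested ts S p u})"
proof -
  \<comment> \<open>Few enough bins for \<open>2 * b \<le> card S\<close>, enough for
    \<open>K \<le> 8 * b\<close>; with \<open>G = 2 ^ 27\<close> the latter gives the
    \<open>2 ^ 24 * K\<close> slots needed by the counting of maps.\<close>
  define b where "b = max 1 (K div 4)"
  have b: "0 < b" "b \<le> K" "K \<le> 8 * b" using K by (auto simp: b_def)
  define m where "m = b * G"
  have G0: "0 < G" by (simp add: G)
  have m: "0 < m" "2 ^ 24 * K \<le> m"
    using b G by (auto simp: m_def)
  let ?X = "{1..N}"
  define \<B> where "\<B> = {S. S \<subseteq> ?X \<and> card S \<le> K \<and> K < 2 * card S}"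
  have fin\<B>: "finite \<B>" by (rule finite_subset[of _ "Pow ?X"]) (auto simp: \<B>_def)
  have \<B>: "S \<subseteq> ?X \<and> K \<le> 2 * card S \<and> 2 ^ 24 * card S \<le> m" if "S \<in> \<B>" for S
    using that m(2) by (auto simp: \<B>_def intro: order_trans[rotated])
  obtain fs where fs: "length fs = d"
    "2 ^ (K * d) * card {S \<in> \<B>. \<forall>f\<in>set fs. 8 * card (f ` S) < 7 * card S} \<le> card \<B>"
    and fsm: "set fs \<subseteq> ?X \<rightarrow>\<^sub>E {..<m}"
    using ex_maps_few_failures[of ?X m \<B> K d] \<B> m by auto
  \<comment> \<open>By the choice of \<open>d\<close>, \<open>\<B>\<close> has fewer than
    \<open>2 ^ (K * d)\<close> members, so the number of those on which all maps fail is below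
    1.\<close>
  have "card \<B> * K ^ K \<le> card {S. S \<subseteq> ?X \<and> card S \<le> K} * K ^ K"
    by (intro mult_right_mono card_mono) (auto simp: \<B>_def)
  also have "\<dots> \<le> (4 * N) ^ K"
    using K by (intro card_small_subsets_le) auto
  also have "\<dots> < (K * 2 ^ d) ^ K" using d K by (intro power_strict_mono) auto
  also have "\<dots> = 2 ^ (K * d) * K ^ K"
    by (metis mult.commute power_mult power_mult_distrib)
  finally have "card \<B> < 2 ^ (K * d)" by simp
  then have "card {S \<in> \<B>. \<forall>f\<in>set fs. 8 * card (f ` S) < 7 * card S} = 0"
    using fs(2) by (cases "card {S \<in> \<B>. \<forall>f\<in>set fs. 8 * card (f ` S) < 7 * card S}") auto
  then have good: "\<exists>f\<in>set fs. 7 * card S \<le> 8 * card (f ` S)" if "S \<in> \<B>" for S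
    using that fin\<B> by (auto simp: not_less)
  define cl where "cl c = {y. y < m \<and> y mod b = c}" for c
  have cl: "finite (cl c)" "card (cl c) \<le> G" for c
    using card_residue_class_le[OF b(1)] by (auto simp: cl_def m_def)
  define test :: "(nat \<Rightarrow> nat) \<Rightarrow> nat \<Rightarrow> nat \<Rightarrow> nat set \<times> nat set"
    where "test f x y = ({v. f v = x}, {v. f v = y})" for f x y
  \<comment> \<open>Both orders of a pair occur, since only a device in the first slot can
    pass.\<close>
  define \<T> where "\<T> = (\<Union>f\<in>set fs. \<Union>x<m. \<Union>y\<in>cl (x mod b) - {x}. {test f x y})"
  have fin\<T>: "finite \<T>" using cl by (auto simp: \<T>_def)
  have len: "card (set fs) \<le> d" using fs(1) card_length by blast
  have UN_le: "card (\<Union>i\<in>I. F i) \<le> card I * k" if "finite I" "\<And>i. i \<in> I \<Longrightarrow> card (F i) \<le> k"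
    for I :: "'i set" and F :: "'i \<Rightarrow> (nat set \<times> nat set) set" and k :: nat
    using card_UN_le[OF that(1), of F] sum_bounded_above[of I "\<lambda>i. card (F i)" k] that(2) by simp
  have cl_le: "card (cl c - {x}) * 1 \<le> G" for c x
    using cl card_Diff1_le[of "cl c" x] by (auto intro: order_trans)
  have "card \<T> \<le> card (set fs) * (card {..<m} * G)"
    unfolding \<T>_def by (intro UN_le order_trans[OF UN_le cl_le]) (use cl in auto)
  also have "\<dots> \<le> d * (K * G * G)"
    using len b by (intro mult_mono) (auto simp: m_def)
  finally have card\<T>: "card \<T> \<le> d * K * G\<^sup>2" by (simp add: power2_eq_square mult.assoc)
  obtain ts where ts: "set ts = \<T>" "distinct ts"
    using finite_distinct_list[OF fin\<T>] by blast
  have "length ts = card \<T>" using ts distinct_card by metis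
  moreover have "\<forall>T\<in>set ts. fst T \<inter> snd T = {}"
    unfolding ts(1) by (auto simp: \<T>_def test_def)
  moreover have "card {p. p < length ts \<and> v \<in> fst (ts ! p) \<union> snd (ts ! p)} \<le> 2 * d * G" for v
  proof -
    have "card {p. p < length ts \<and> v \<in> fst (ts ! p) \<union> snd (ts ! p)}
        \<le> card {T \<in> \<T>. v \<in> fst T \<union> snd T}"
      using ts fin\<T> by (intro card_inj_on_le[of "(!) ts"]) (auto simp: inj_on_nth)
    also have "\<dots> \<le> card ((\<Union>f\<in>set fs. \<Union>y\<in>cl (f v mod b). {test f (f v) y})
        \<union> (\<Union>f\<in>set fs. \<Union>x\<in>cl (f v mod b). {test f x (f v)}))"
    proof (intro card_mono subsetI)
      fix T assume *: "T \<in> {T \<in> \<T>. v \<in> fst T \<union> snd T}"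
      then obtain f x y where T: "f \<in> set fs" "x < m" "y \<in> cl (x mod b)" "T = test f x y"
        unfolding \<T>_def by blast
      moreover have "x = f v \<or> y = f v" using * T(4) by (auto simp: test_def)
      ultimately have "x = f v \<and> y \<in> cl (f v mod b) \<or> y = f v \<and> x \<in> cl (f v mod b)"
        by (auto simp: cl_def)
      then show "T \<in> (\<Union>f\<in>set fs. \<Union>y\<in>cl (f v mod b). {test f (f v) y})
          \<union> (\<Union>f\<in>set fs. \<Union>x\<in>cl (f v mod b). {test f x (f v)})"
        using T(1,4) by blast
    qed (use cl in auto)
    also have "\<dots> \<le> card (\<Union>f\<in>set fs. \<Union>y\<in>cl (f v mod b). {test f (f v) y})
        + card (\<Union>f\<in>set fs. \<Union>x\<in>cl (f v mod b). {test f x (f v)})"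
      by (rule card_Un_le)
    also have "\<dots> \<le> card (set fs) * G + card (set fs) * G"
    proof (intro add_mono UN_le)
      fix f
      show "card (\<Union>y\<in>cl (f v mod b). {test f (f v) y}) \<le> G"
        using UN_le[OF cl(1), of "f v mod b" "\<lambda>y. {test f (f v) y}" 1] cl(2)[of "f v mod b"] by simp
      show "card (\<Union>x\<in>cl (f v mod b). {test f x (f v)}) \<le> G"
        using UN_le[OF cl(1), of "f v mod b" "\<lambda>x. {test f x (f v)}" 1] cl(2)[of "f v mod b"] by simp
    qed auto
    also have "\<dots> = 2 * card (set fs) * G" by (simp only: mult_2 add_mult_distrib)
    also have "\<dots> \<le> 2 * d * G" using len by (intro mult_right_mono) auto
    finally show ?thesis .
  qed
  moreover have "K \<le> 8 * card {u \<in> S. \<exists>p<length ts. tested ts S p u}"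
    if S: "S \<subseteq> ?X \<and> card S \<le> K \<and> K < 2 * card S" for S
  proof -
    obtain f where f: "f \<in> set fs" "7 * card S \<le> 8 * card (f ` S)"
      using good S by (auto simp: \<B>_def)
    have finS: "finite S" using S finite_subset by blast
    let ?V = "{u \<in> S. \<exists>w\<in>S. f w \<noteq> f u \<and> f w mod b = f u mod b \<and>
           {x \<in> S. f x = f u} = {u} \<and> {x \<in> S. f x = f w} = {w}}"
    have "2 * b \<le> card S" using S K by (auto simp: b_def)
    then have "card S \<le> 4 * card ?V" using finS f b by (intro card_tested_ge)
    also have "card ?V \<le> card {u \<in> S. \<exists>p<length ts. tested ts S p u}"
    proof (intro card_mono subsetI)
      fix u assume "u \<in> ?V"
      then obtain w where w: "u \<in> S" "w \<in> S" "f w \<noteq> f u" "f w mod b = f u mod b"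
        "{x \<in> S. f x = f u} = {u}" "{x \<in> S. f x = f w} = {w}" by blast
      have "f x < m" if "x \<in> S" for x
        using fsm f(1) S that by auto
      then have "test f (f u) (f w) \<in> set ts"
        unfolding ts(1) \<T>_def using f w by (auto simp: cl_def)
      then obtain p where p: "p < length ts" "ts ! p = test f (f u) (f w)"
        by (metis in_set_conv_nth)
      have "{v. f v = y} \<inter> S = {x \<in> S. f x = y}" for y by blast
      then have "tested ts S p u"
        unfolding tested_def p(2) test_def using w(5,6) by (intro conjI exI[of _ w]) simp_all
      then show "u \<in> {u \<in> S. \<exists>p<length ts. tested ts S p u}" using w(1) p(1) by blast
    qed (use finS in auto)
    finally show ?thesis using S by linarith
  qed
  ultimately show ?thesis using card\<T> by (intro exI[of _ ts]) auto
qed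

section \<open>The queue\<close>

lemma no_cd_feedback_Received:
  assumes "{x \<in> S. \<exists>m. a x = Transmit m} = {u}" "a u = Transmit m" "a v = Listen"
  shows "no_cd_feedback S a v = Received m"
proof -
  have "x \<in> S \<and> (\<exists>m. a x = Transmit m) \<longleftrightarrow> x = u" for x using assms(1) by blast
  moreover from this have "(\<exists>x\<in>S. a x = Transmit k) \<longleftrightarrow> k = m" for k
    using assms(2) by (metis action.inject)
  ultimately show ?thesis using assms(3) by (simp add: no_cd_feedback_def)
qed

lemma no_cd_feedback_not_Received:
  assumes "\<nexists>u. {x \<in> S. \<exists>m. a x = Transmit m} = {u}"
  shows "no_cd_feedback S a v \<noteq> Received m"
proof -
  have "\<not> (\<exists>!u. u \<in> S \<and> (\<exists>m. a u = Transmit m))" using assms by auto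
  then show ?thesis by (auto simp: no_cd_feedback_def split: action.split)
qed

lemma no_cd_feedback_Received_iff:
  "(\<exists>m. no_cd_feedback S a v = Received m) \<longleftrightarrow>
     a v = Listen \<and> (\<exists>u. {x \<in> S. \<exists>m. a x = Transmit m} = {u})"
  (is "?l \<longleftrightarrow> ?r")
proof
  assume ?l
  then have "a v = Listen" by (auto simp: no_cd_feedback_def split: action.splits)
  then show ?r using \<open>?l\<close> no_cd_feedback_not_Received[of S a v] by blast
next
  assume ?r
  then obtain u where u: "{x \<in> S. \<exists>m. a x = Transmit m} = {u}" "a v = Listen" by blast
  moreover from this obtain m where "a u = Transmit m" by blast
  ultimately show ?l using no_cd_feedback_Received by blast
qed

text \<open>
  A device with tenure \<open>Some a\<close> has joined the queue and serves at the positions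
  \<open>a, \<dots>, a + c - 1\<close>.  Only while it serves is its horizon meaningful: it is then the end of the
  last service period granted so far.  The flag carries over what was heard in earlier rounds of
  the same test.
\<close>

datatype status = Status (tenure: "nat option") (horizon: nat) (flag: bool)

definition holds :: "nat \<Rightarrow> nat \<Rightarrow> status \<Rightarrow> bool" where
  "holds c p s \<longleftrightarrow> (\<exists>a. tenure s = Some a \<and> a \<le> p \<and> p < a + c)"

lemma holds_Status [simp]:
  "holds c p (Status (tenure s) h f) = holds c p s"
  "\<not> holds c p (Status None h f)"
  by (auto simp: holds_def)

text \<open>
  Each test \<open>(A, B)\<close> takes four rounds: \<open>A\<close> transmits to \<open>B\<close>; the devices of \<open>B\<close> that heard
  something answer; a device of \<open>A\<close> that got an answer, hence is alone in \<open>A\<close>, asks the serving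
  device to let it join; the serving device transmits the new horizon to the newcomer and to the
  device that is about to take over.  A newcomer that hears nothing finds the queue empty and
  serves at once.
\<close>

definition out :: "(nat set \<times> nat set) list \<Rightarrow> nat \<Rightarrow> nat \<Rightarrow> nat \<Rightarrow> status \<Rightarrow> action" where
  "out ts c v t s =
     (let p = t div 4; q = t mod 4; A = fst (ts ! p); B = snd (ts ! p) in
      if length ts \<le> p then (if holds c p s then Transmit 0 else Listen)
      else if q = 0 then (if v \<in> A then Transmit 0 else if v \<in> B then Listen else Idle)
      else if q = 1 then
        (if v \<in> A then Listen else if v \<in> B \<and> flag s then Transmit 0 else Idle)
      else if q = 2 then
        (if holds c p s then Listen else if flag s then Transmit 0 else Idle)
      else
        (if holds c p s then Transmit (if flag s then horizon s + c else horizon s)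
         else if flag s \<or> tenure s = Some (p + 1) then Listen else Idle))"

text \<open>After the first three rounds the flag means in turn: a transmission was heard; the
  device is a newcomer; it is a newcomer or serves and has heard one. In the last round a newcomer
  hears an end \<open>e\<close> that includes its own period, which therefore starts at
  \<open>e - c\<close>.\<close>

definition update :: "nat \<Rightarrow> nat \<Rightarrow> status \<Rightarrow> feedback \<Rightarrow> status" where
  "update c t s fb =
     (let p = t div 4; q = t mod 4; r = (\<exists>m. fb = Received m) in
      if q = 0 then Status (tenure s) (horizon s) r
      else if q = 1 then Status (tenure s) (horizon s) (tenure s = None \<and> r)
      else if q = 2 then Status (tenure s) (horizon s) (flag s \<or> r)
      else if holds c p s then
        Status (tenure s) (if flag s then horizon s + c else horizon s) False
      else if tenure s = None \<and> flag s then
        (case fb of Received e \<Rightarrow> Status (Some (e - c)) e False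
         | _ \<Rightarrow> Status (Some p) (p + c) False)
      else
        (case fb of Received e \<Rightarrow> Status (tenure s) e False
         | _ \<Rightarrow> Status (tenure s) (horizon s) False))"

definition run :: "nat \<Rightarrow> feedback list \<Rightarrow> status" where
  "run c h = snd (foldl (\<lambda>(t, s) fb. (Suc t, update c t s fb)) (0, Status None 0 False) h)"

text \<open>The one round after all tests is the announcement by the leader.\<close>

definition queue_device :: "(nat set \<times> nat set) list \<Rightarrow> nat \<Rightarrow> nat \<Rightarrow> device" where
  "queue_device ts c v =
     Device (\<lambda>h. out ts c v (length h) (run c h))
       (\<lambda>h. if length h = 4 * length ts + 1
            then Some (if holds c (length ts) (run c h) then Leader else Non_Leader) else None)"

lemma run_snoc: "run c (h @ [fb]) = update c (length h) (run c h) fb"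
proof -
  have "fst (foldl (\<lambda>(t, s) fb. (Suc t, update c t s fb)) (0, s0) h) = length h" for s0
    by (induction h rule: rev_induct) (auto simp: split_beta)
  then show ?thesis by (simp add: run_def split_beta)
qed

lemma length_history [simp]: "length (history P S t v) = t"
  by (induction t) auto

lemma tenure_update: "tenure s = Some a \<Longrightarrow> tenure (update c t s fb) = Some a"
  by (auto simp: update_def Let_def split: feedback.split)

section \<open>The rounds of a single test\<close>

locale queue =
  fixes ts :: "(nat set \<times> nat set) list" and c :: nat and S :: "nat set"
  assumes finite_S: "finite S" and c_pos: "0 < c"
    and disjoint: "\<And>T. T \<in> set ts \<Longrightarrow> fst T \<inter> snd T = {}"
begin

definition st :: "nat \<Rightarrow> nat \<Rightarrow> status" where
  "st t v = run c (history (queue_device ts c) S t v)"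

definition sent :: "nat \<Rightarrow> nat \<Rightarrow> action" where
  "sent t v = action_in (queue_device ts c) S t v"

lemma sent_eq: "sent t v = out ts c v t (st t v)"
  by (simp add: sent_def action_in_def st_def queue_device_def)

lemma st_0: "st 0 v = Status None 0 False"
  by (simp add: st_def run_def)

lemma st_Suc: "st (Suc t) v = update c t (st t v) (no_cd_feedback S (sent t) v)"
proof -
  have "sent t = (\<lambda>u. act (queue_device ts c u) (history (queue_device ts c) S t u))"
    by (simp add: fun_eq_iff sent_def action_in_def)
  then show ?thesis by (simp add: st_def run_snoc)
qed

lemma tenure_mono:
  assumes "tenure (st t v) = Some a" "t \<le> t'"
  shows "tenure (st t' v) = Some a"
  using assms(2)
proof (induction rule: dec_induct)
  case base
  show ?case by (rule assms(1))
next
  case (step n)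
  then show ?case unfolding st_Suc by (intro tenure_update)
qed

text \<open>Devices already in the queue are excluded, so each device is granted one period, however
  many tests it passes.\<close>

definition joins :: "nat \<Rightarrow> nat \<Rightarrow> bool" where
  "joins p v \<longleftrightarrow> tenure (st (4 * p) v) = None \<and> tested ts S p v"

lemma joins_unique: "joins p u \<Longrightarrow> joins p v \<Longrightarrow> u = v"
  by (auto simp: joins_def tested_def)

lemma st_1:
  assumes "p < length ts"
  shows "st (Suc (4 * p)) v = Status (tenure (st (4 * p) v)) (horizon (st (4 * p) v))
           (v \<in> snd (ts ! p) \<and> (\<exists>u. fst (ts ! p) \<inter> S = {u}))"
proof -
  have "{x \<in> S. \<exists>m. sent (4 * p) x = Transmit m} = fst (ts ! p) \<inter> S"
    using assms by (auto simp: sent_eq out_def)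
  moreover have "sent (4 * p) v = Listen \<longleftrightarrow> v \<in> snd (ts ! p)"
    using assms disjoint[of "ts ! p"] by (auto simp: sent_eq out_def)
  ultimately show ?thesis
    by (simp add: st_Suc update_def no_cd_feedback_Received_iff)
qed

text \<open>Nobody in \<open>B\<close> answers unless exactly one device of \<open>A\<close> is
  present. If so, all devices present in \<open>B\<close> answer, and reception shows that there is
  just one of them.\<close>

lemma st_2:
  assumes "p < length ts" "v \<in> S"
  shows "st (Suc (Suc (4 * p))) v = Status (tenure (st (4 * p) v)) (horizon (st (4 * p) v)) (joins p v)"
proof -
  have [simp]: "Suc (4 * p) div 4 = p" "Suc (4 * p) mod 4 = 1" by presburger+
  let ?A = "fst (ts ! p)" and ?B = "snd (ts ! p)"
  have tr: "{x \<in> S. \<exists>m. sent (Suc (4 * p)) x = Transmit m}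
      = (if \<exists>u. ?A \<inter> S = {u} then ?B \<inter> S else {})"
    using assms disjoint[of "ts ! p"] by (auto simp: sent_eq out_def st_1[OF assms(1)])
  have listen: "sent (Suc (4 * p)) v = Listen \<longleftrightarrow> v \<in> ?A"
    using assms by (auto simp: sent_eq out_def)
  have "v \<in> ?A \<and> (\<exists>w. (if \<exists>u. ?A \<inter> S = {u} then ?B \<inter> S else {}) = {w})
      \<longleftrightarrow> ?A \<inter> S = {v} \<and> (\<exists>w. ?B \<inter> S = {w})"
  proof (cases "\<exists>u. ?A \<inter> S = {u}")
    case True
    then obtain u where u: "?A \<inter> S = {u}" by blast
    moreover have "v \<in> ?A \<inter> S \<longleftrightarrow> v = u" using u by simp
    then have "v \<in> ?A \<longleftrightarrow> u = v" using assms(2) by auto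
    ultimately show ?thesis by simp
  next
    case False
    then show ?thesis by auto
  qed
  then have "(\<exists>m. no_cd_feedback S (sent (Suc (4 * p))) v = Received m)
      \<longleftrightarrow> ?A \<inter> S = {v} \<and> (\<exists>w. ?B \<inter> S = {w})"
    unfolding no_cd_feedback_Received_iff tr listen .
  then show ?thesis
    by (simp add: st_Suc[of "Suc (4 * p)"] update_def Let_def st_1[OF assms(1)] joins_def tested_def)
qed

text \<open>At most one device joins, so its request cannot collide.\<close>

lemma st_3:
  assumes "p < length ts" "v \<in> S"
  shows "st (4 * p + 3) v = Status (tenure (st (4 * p) v)) (horizon (st (4 * p) v))
           (joins p v \<or> holds c p (st (4 * p) v) \<and> (\<exists>u\<in>S. joins p u))"
proof -
  have [simp]: "Suc (Suc (4 * p)) div 4 = p" "Suc (Suc (4 * p)) mod 4 = 2" by presburger+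
  have h: "holds c p (st (Suc (Suc (4 * p))) x) = holds c p (st (4 * p) x)" if "x \<in> S" for x
    using that by (simp add: st_2[OF assms(1)] holds_def)
  have tr: "{x \<in> S. \<exists>m. sent (Suc (Suc (4 * p))) x = Transmit m} = {x \<in> S. joins p x}"
    using assms h by (auto simp: sent_eq out_def st_2[OF assms(1)] holds_def joins_def)
  have single: "(\<exists>u. {x \<in> S. joins p x} = {u}) \<longleftrightarrow> (\<exists>u\<in>S. joins p u)"
  proof
    assume "\<exists>u\<in>S. joins p u"
    then obtain u where u: "u \<in> S" "joins p u" ..
    have "joins p x \<longleftrightarrow> x = u" for x using joins_unique[OF u(2), of x] u(2) by metis
    then have "{x \<in> S. joins p x} = {u}" using u(1) by auto
    then show "\<exists>u. {x \<in> S. joins p x} = {u}" ..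
  qed auto
  have listen: "sent (Suc (Suc (4 * p))) v = Listen \<longleftrightarrow> holds c p (st (4 * p) v)"
    using assms h by (auto simp: sent_eq out_def)
  have "(\<exists>m. no_cd_feedback S (sent (Suc (Suc (4 * p)))) v = Received m)
      \<longleftrightarrow> holds c p (st (4 * p) v) \<and> (\<exists>u\<in>S. joins p u)"
    unfolding no_cd_feedback_Received_iff tr listen single ..
  moreover have "st (4 * p + 3) v = update c (Suc (Suc (4 * p))) (st (Suc (Suc (4 * p))) v)
      (no_cd_feedback S (sent (Suc (Suc (4 * p)))) v)"
    using st_Suc[of "Suc (Suc (4 * p))" v] by (simp add: numeral_3_eq_3)
  ultimately show ?thesis
    by (simp add: update_def Let_def st_2[OF assms])
qed

section \<open>The queue invariant\<close>

text \<open>State after \<open>p\<close> tests, with \<open>e\<close> standing for the end of the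
  last period granted. Periods are disjoint and leave no gap between \<open>p\<close> and
  \<open>e\<close>, so somebody serves at \<open>p\<close> exactly if \<open>p < e\<close>. The
  bound of \<open>e\<close> by the total length granted finally shows that service has not run
  out.\<close>

definition invariant :: "nat \<Rightarrow> nat \<Rightarrow> bool" where
  "invariant p e \<longleftrightarrow>
     (\<forall>u\<in>S. \<forall>a. tenure (st (4 * p) u) = Some a \<longrightarrow> a + c \<le> e) \<and>
     (\<forall>x u v. u \<in> S \<and> v \<in> S \<and> holds c x (st (4 * p) u) \<and> holds c x (st (4 * p) v) \<longrightarrow> u = v) \<and>
     (\<forall>x. p \<le> x \<and> x < e \<longrightarrow> (\<exists>u\<in>S. holds c x (st (4 * p) u))) \<and>
     (\<forall>u\<in>S. holds c p (st (4 * p) u) \<longrightarrow> horizon (st (4 * p) u) = e) \<and>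
     c * card {u \<in> S. tenure (st (4 * p) u) \<noteq> None} \<le> e \<and>
     (\<forall>u\<in>S. tenure (st (4 * p) u) \<noteq> None \<longleftrightarrow> (\<exists>p'<p. tested ts S p' u))"

lemma invariantD:
  assumes "invariant p e"
  shows "\<And>u a. u \<in> S \<Longrightarrow> tenure (st (4 * p) u) = Some a \<Longrightarrow> a + c \<le> e"
    and "\<And>x u v. u \<in> S \<Longrightarrow> v \<in> S \<Longrightarrow> holds c x (st (4 * p) u) \<Longrightarrow> holds c x (st (4 * p) v)
           \<Longrightarrow> u = v"
    and "\<And>x. p \<le> x \<Longrightarrow> x < e \<Longrightarrow> \<exists>u\<in>S. holds c x (st (4 * p) u)"
    and "\<And>u. u \<in> S \<Longrightarrow> holds c p (st (4 * p) u) \<Longrightarrow> horizon (st (4 * p) u) = e"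
    and "c * card {u \<in> S. tenure (st (4 * p) u) \<noteq> None} \<le> e"
    and "\<And>u. u \<in> S \<Longrightarrow> tenure (st (4 * p) u) \<noteq> None \<longleftrightarrow> (\<exists>p'<p. tested ts S p' u)"
  subgoal using assms[unfolded invariant_def, THEN conjunct1] by blast
  subgoal using assms[unfolded invariant_def, THEN conjunct2, THEN conjunct1] by blast
  subgoal using assms[unfolded invariant_def, THEN conjunct2, THEN conjunct2, THEN conjunct1] by blast
  using assms[unfolded invariant_def, THEN conjunct2, THEN conjunct2, THEN conjunct2] by simp_all

lemma invariant_0: "invariant 0 0"
  by (simp add: invariant_def st_0 holds_def)

text \<open>If \<open>p < e\<close>, a single device serves and every listener receives
  \<open>e'\<close> from it. Otherwise nobody serves, and a newcomer recognises the empty queue by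
  silence and starts at \<open>p = max e p\<close>.\<close>

lemma st_4:
  assumes p: "p < length ts" and v: "v \<in> S" and invariant: "invariant p e"
    and e': "e' = (if \<exists>u\<in>S. joins p u then max e p + c else e)"
  shows "tenure (st (4 * p + 4) v) =
           (if joins p v then Some (max e p) else tenure (st (4 * p) v))"
    and "holds c (p + 1) (st (4 * p + 4) v) \<Longrightarrow> horizon (st (4 * p + 4) v) = e'"
proof -
  let ?s = "st (4 * p)"
  have [simp]: "(4 * p + 3) div 4 = p" "(4 * p + 3) mod 4 = 3" by presburger+
  have ten: "tenure (st (4 * p + 3) x) = tenure (?s x)" if "x \<in> S" for x
    using that by (simp add: st_3[OF p])
  have h: "holds c p (st (4 * p + 3) x) = holds c p (?s x)" if "x \<in> S" for x
    using that ten by (simp add: holds_def)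
  have hf: "horizon (?s x) = e" "p < e" if "x \<in> S" "holds c p (?s x)" for x
    using invariantD(4)[OF invariant that] invariantD(1)[OF invariant that(1)] that(2) by (fastforce simp: holds_def)+
  have tr: "sent (4 * p + 3) x =
      (if holds c p (?s x) then Transmit e'
       else if joins p x \<or> tenure (?s x) = Some (p + 1) then Listen else Idle)" if "x \<in> S" for x
    using that p hf[OF that] h[OF that] ten[OF that] e'
    by (auto simp: sent_eq out_def Let_def st_3[OF p] holds_def joins_def)
  have up: "st (4 * p + 4) v
      = update c (4 * p + 3) (st (4 * p + 3) v) (no_cd_feedback S (sent (4 * p + 3)) v)"
  proof -
    have "4 * p + 4 = Suc (4 * p + 3)" by simp
    then show ?thesis by (simp only: st_Suc)
  qed
  have heard: "no_cd_feedback S (sent (4 * p + 3)) v = Received e'"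
    if pe: "p < e" and listen: "sent (4 * p + 3) v = Listen"
  proof -
    obtain l where l: "l \<in> S" "holds c p (?s l)"
      using invariantD(3)[OF invariant order_refl pe] by blast
    have "holds c p (?s x) \<longleftrightarrow> x = l" if "x \<in> S" for x
      using invariantD(2)[OF invariant that l(1)] l(2) by metis
    then have "(\<exists>m. sent (4 * p + 3) x = Transmit m) \<longleftrightarrow> x = l" if "x \<in> S" for x
      using that tr[OF that] by simp
    then have "{x \<in> S. \<exists>m. sent (4 * p + 3) x = Transmit m} = {l}"
      using l(1) by (simp add: set_eq_iff) metis
    then show ?thesis using listen l tr[of l] by (intro no_cd_feedback_Received) auto
  qed
  have silent: "no_cd_feedback S (sent (4 * p + 3)) v \<noteq> Received k" if "\<not> p < e" for k
  proof -
    have "{x \<in> S. \<exists>m. sent (4 * p + 3) x = Transmit m} = {}"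
      using hf that by (auto simp: tr split: if_splits)
    then show ?thesis by (intro no_cd_feedback_not_Received) (metis insert_not_empty)
  qed
  have joiner: "tenure (?s v) = None \<and> \<not> holds c p (?s v)" if "joins p v"
    using that by (simp add: joins_def holds_def)
  show "tenure (st (4 * p + 4) v) =
           (if joins p v then Some (max e p) else tenure (?s v))"
  proof (cases "joins p v")
    case True
    then have "e' = max e p + c" "sent (4 * p + 3) v = Listen"
      using e' v tr[OF v] joiner by auto
    then show ?thesis
      using True joiner heard silent v unfolding up
      by (cases "p < e") (auto simp: update_def Let_def st_3[OF p] h split: feedback.split)
  next
    case False
    then show ?thesis
      using v unfolding up
      by (auto simp: update_def Let_def st_3[OF p] holds_def split: feedback.split)
  qed
  note ten4 = this
  assume hold: "holds c (p + 1) (st (4 * p + 4) v)"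
  show "horizon (st (4 * p + 4) v) = e'"
  proof (cases "joins p v")
    case True
    then have "e' = max e p + c" "sent (4 * p + 3) v = Listen"
      using e' v tr[OF v] joiner by auto
    then show ?thesis
      using True joiner heard silent v unfolding up
      by (cases "p < e") (auto simp: update_def Let_def st_3[OF p] h split: feedback.split)
  next
    case False
    show ?thesis
    proof (cases "holds c p (?s v)")
      case True
      then have "(if \<exists>u\<in>S. joins p u then e + c else e) = e'"
        using hf[OF v] e' by auto
      then show ?thesis
        using True False hf[OF v] v h[OF v] unfolding up
        by (auto simp: update_def Let_def st_3[OF p])
    next
      case not_holds: False
      \<comment> \<open>This device takes over at \<open>p + 1\<close>. Its period ends by
        \<open>e\<close>, so \<open>p < e\<close>, and the device serving at \<open>p\<close> tells
        it \<open>e'\<close>.\<close>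
      obtain a where "tenure (?s v) = Some a" "a \<le> p + 1" "p + 1 < a + c"
        using hold False ten4 by (auto simp: holds_def)
      moreover from this have "\<not> a \<le> p" using not_holds by (auto simp: holds_def)
      ultimately have a: "tenure (?s v) = Some (p + 1)" by (simp add: le_Suc_eq)
      then have "p < e" using invariantD(1)[OF invariant v] by fastforce
      moreover have "sent (4 * p + 3) v = Listen" using a not_holds tr[OF v] by simp
      ultimately show ?thesis
        using heard a not_holds h[OF v] v unfolding up
        by (auto simp: update_def Let_def st_3[OF p])
    qed
  qed
qed

text \<open>A new period starts at \<open>max e p\<close>, after all older ones and without a gap
  from \<open>Suc p\<close> on. It raises the end by at least \<open>c\<close> while one device is
  added to the queue.\<close>

lemma invariant_Suc:
  assumes p: "p < length ts" and invariant: "invariant p e"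
  shows "\<exists>e'. invariant (Suc p) e'"
proof
  define e' where "e' = (if \<exists>u\<in>S. joins p u then max e p + c else e)"
  let ?s = "st (4 * p)" and ?s' = "st (4 * p + 4)"
  have eq: "4 * Suc p = 4 * p + 4" by simp
  note ten = st_4(1)[OF p _ invariant e'_def]
  note i1 = invariantD(1)[OF invariant] and i2 = invariantD(2)[OF invariant] and i3 = invariantD(3)[OF invariant]
    and i5 = invariantD(5)[OF invariant] and i6 = invariantD(6)[OF invariant]
  have ee': "e \<le> e'" by (auto simp: e'_def)
  have hold: "holds c x (?s' u) \<longleftrightarrow>
      (if joins p u then max e p \<le> x \<and> x < max e p + c else holds c x (?s u))"
    if "u \<in> S" for u x
    using ten[OF that] by (auto simp: holds_def)
  have old: "x < e" if "u \<in> S" "holds c x (?s u)" for u x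
    using i1[OF that(1)] that(2) by (fastforce simp: holds_def)
  have 1: "a + c \<le> e'" if "u \<in> S" "tenure (?s' u) = Some a" for u a
  proof (cases "joins p u")
    case True
    then show ?thesis using ten[OF that(1)] that by (auto simp: e'_def)
  next
    case False
    then show ?thesis using ten[OF that(1)] that i1[OF that(1), of a] ee' by simp
  qed
  have 2: "u = v" if "u \<in> S" "v \<in> S" "holds c x (?s' u)" "holds c x (?s' v)" for x u v
    using that hold[of u x] hold[of v x] joins_unique[of p u v] old[of u x] old[of v x] i2[of u v x]
    by (auto split: if_splits)
  have 3: "\<exists>u\<in>S. holds c x (?s' u)" if "Suc p \<le> x" "x < e'" for x
  proof (cases "x < e")
    case True
    then obtain u where u: "u \<in> S" "holds c x (?s u)" using i3[of x] \<open>Suc p \<le> x\<close> by auto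
    then have "\<not> joins p u" by (auto simp: holds_def joins_def)
    then show ?thesis using u hold by auto
  next
    case False
    then obtain u where "u \<in> S" "joins p u" "x < max e p + c"
      using \<open>x < e'\<close> by (auto simp: e'_def split: if_splits)
    then show ?thesis using hold[of u x] False \<open>Suc p \<le> x\<close> by (intro bexI[of _ u]) auto
  qed
  have 5: "c * card {u \<in> S. tenure (?s' u) \<noteq> None} \<le> e'"
  proof (cases "\<exists>u\<in>S. joins p u")
    case True
    then obtain u where u: "u \<in> S" "joins p u" by blast
    have "joins p x \<longleftrightarrow> x = u" for x using joins_unique[OF u(2), of x] u(2) by metis
    then have "{u \<in> S. tenure (?s' u) \<noteq> None} = insert u {u \<in> S. tenure (?s u) \<noteq> None}"
      using ten u(1) by auto
    moreover have "u \<notin> {u \<in> S. tenure (?s u) \<noteq> None}" using u by (simp add: joins_def)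
    ultimately have "card {u \<in> S. tenure (?s' u) \<noteq> None}
        = Suc (card {u \<in> S. tenure (?s u) \<noteq> None})"
      using finite_S by simp
    then show ?thesis using i5 True by (auto simp: e'_def)
  next
    case False
    then have "{u \<in> S. tenure (?s' u) \<noteq> None} = {u \<in> S. tenure (?s u) \<noteq> None}"
      using ten by auto
    then show ?thesis using i5 ee' by simp
  qed
  have 6: "tenure (?s' u) \<noteq> None \<longleftrightarrow> (\<exists>p'<Suc p. tested ts S p' u)" if "u \<in> S" for u
    using ten[OF that] i6[OF that] by (auto simp: joins_def less_Suc_eq)
  have 4: "horizon (?s' u) = e'" if "u \<in> S" "holds c (Suc p) (?s' u)" for u
    using st_4(2)[OF p that(1) invariant e'_def] that(2) by simp
  show "invariant (Suc p) e'"
    unfolding invariant_def eq using 1 2 3 4 5 6 by (intro conjI) blast+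
qed

lemma ex_invariant: "p \<le> length ts \<Longrightarrow> \<exists>e. invariant p e"
proof (induction p)
  case (Suc p)
  then show ?case using invariant_Suc[of p] by auto
qed (use invariant_0 in blast)

section \<open>Correctness and energy of the queue protocol\<close>

text \<open>Each device that passes a test accounts for \<open>c\<close> positions, so the end
  \<open>e\<close> exceeds \<open>length ts\<close>, and the invariant yields exactly one device
  serving at position \<open>length ts\<close>.\<close>

lemma elects_leader_queue:
  assumes "length ts < c * card {u \<in> S. \<exists>p<length ts. tested ts S p u}"
  shows "elects_leader (queue_device ts c) S (4 * length ts + 1)"
proof -
  let ?R = "length ts"
  obtain e where e: "invariant ?R e" using ex_invariant by blast
  then have "{u \<in> S. tenure (st (4 * ?R) u) \<noteq> None} = {u \<in> S. \<exists>p<?R. tested ts S p u}"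
    using invariantD(6) by blast
  then have "?R < e" using invariantD(5)[OF e] assms by simp
  then obtain l where l: "l \<in> S" "holds c ?R (st (4 * ?R) l)"
    using invariantD(3)[OF e order_refl] by blast
  moreover have "u = l" if "u \<in> S" "holds c ?R (st (4 * ?R) u)" for u
    using invariantD(2)[OF e] l that by blast
  ultimately have hold: "holds c ?R (st (4 * ?R) u) \<longleftrightarrow> u = l" if "u \<in> S" for u
    using that by blast
  \<comment> \<open>The announcement round changes only the flag, so verdicts agree with who
    transmits in it.\<close>
  moreover have "holds c ?R (st (Suc (4 * ?R)) u) = holds c ?R (st (4 * ?R) u)" for u
    by (simp add: st_Suc update_def holds_def)
  ultimately have hold': "holds c ?R (st (Suc (4 * ?R)) u) \<longleftrightarrow> u = l" if "u \<in> S" for u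
    using that by simp
  have "verdict_after (queue_device ts c) S t u =
      (if t = 4 * ?R + 1 then Some (if holds c ?R (st t u) then Leader else Non_Leader) else None)"
    for t u by (simp add: verdict_after_def queue_device_def st_def del: history.simps)
  moreover have "action_in (queue_device ts c) S (4 * ?R) u
      = (if u = l then Transmit 0 else Listen)" if "u \<in> S" for u
    using hold[OF that] by (simp add: sent_eq out_def flip: sent_def)
  ultimately show ?thesis
    using l(1) hold' by (auto simp: elects_leader_def intro!: bexI[of _ l])
qed

text \<open>Outside the announcement a device is awake only in its tests, during its period, and at
  the position just before, where it listens for the horizon. Each position has four rounds.\<close>

lemma energy_queue_le:
  assumes v: "v \<in> S"
    and D: "card {p. p < length ts \<and> v \<in> fst (ts ! p) \<union> snd (ts ! p)} \<le> D"
  shows "energy (queue_device ts c) S (4 * length ts + 1) v \<le> 4 * (D + c + 1) + 1"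
proof -
  let ?R = "length ts"
  let ?P = "{p. p < ?R \<and> v \<in> fst (ts ! p) \<union> snd (ts ! p)}"
  \<comment> \<open>A tenure never changes once set, so any tenure seen earlier equals
    \<open>a\<close>. Without one, \<open>a\<close> is arbitrary and the interval below only
    enlarges the bound.\<close>
  define a where "a = the (tenure (st (4 * ?R) v))"
  let ?Q = "?P \<union> {a - 1..<a + c}"
  have a: "a' = a" if "tenure (st (4 * p) v) = Some a'" "p < ?R" for a' p
    using tenure_mono[OF that(1), of "4 * ?R"] that(2) by (simp add: a_def)
  have Q: "p \<in> ?Q" if p: "p < ?R" and q: "q < 4" and act: "sent (4 * p + q) v \<noteq> Idle" for p q
  proof -
    have dm [simp]: "(4 * p + q) div 4 = p" "(4 * p + q) mod 4 = q" using q by auto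
    have j: "joins p v \<Longrightarrow> p \<in> ?P" using p by (auto simp: joins_def tested_def)
    have "q = 0 \<or> q = 1 \<or> q = 2 \<or> q = 3" using q by auto
    then have "p \<in> ?P \<or> holds c p (st (4 * p) v) \<or> tenure (st (4 * p) v) = Some (p + 1)"
      using act p j dm unfolding sent_eq out_def Let_def
      by (elim disjE) (auto simp: st_1[OF p] st_2[OF p v] st_3[OF p v] holds_def split: if_splits)
    then show ?thesis using a p c_pos by (fastforce simp: holds_def)
  qed
  have "{t. t < 4 * ?R + 1 \<and> action_in (queue_device ts c) S t v \<noteq> Idle}
      \<subseteq> insert (4 * ?R) ((\<lambda>(p, q). 4 * p + q) ` (?Q \<times> {..<4}))"
  proof
    fix t assume "t \<in> {t. t < 4 * ?R + 1 \<and> action_in (queue_device ts c) S t v \<noteq> Idle}"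
    then have t: "t < 4 * ?R + 1" "sent t v \<noteq> Idle" by (auto simp: sent_def)
    show "t \<in> insert (4 * ?R) ((\<lambda>(p, q). 4 * p + q) ` (?Q \<times> {..<4}))"
    proof (cases "t = 4 * ?R")
      case False
      then have "t div 4 \<in> ?Q" using Q[of "t div 4" "t mod 4"] t by auto
      then show ?thesis
        by (intro insertI2 image_eqI[of _ _ "(t div 4, t mod 4)"]) auto
    qed simp
  qed
  then have "energy (queue_device ts c) S (4 * ?R + 1) v
      \<le> card (insert (4 * ?R) ((\<lambda>(p, q). 4 * p + q) ` (?Q \<times> {..<4})))"
    unfolding energy_def by (intro card_mono) auto
  also have "\<dots> \<le> Suc (card ((\<lambda>(p, q). 4 * p + q) ` (?Q \<times> {..<4})))"
    by (simp add: card_insert_if)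
  also have "\<dots> \<le> Suc (card (?Q \<times> {..<4::nat}))"
    by (intro Suc_leI le_imp_less_Suc card_image_le) auto
  also have "card (?Q \<times> {..<4::nat}) = 4 * card ?Q"
    by (simp add: card_cartesian_product)
  also have "card ?Q \<le> D + (c + 1)"
    using D by (intro order_trans[OF card_Un_le] add_mono) auto
  finally show ?thesis by simp
qed

end

section \<open>Leader election\<close>

definition solo_device :: device where
  "solo_device = Device (\<lambda>h. Transmit 0) (\<lambda>h. if h = [] then None else Some Leader)"

lemma elects_leader_solo: "elects_leader (\<lambda>_. solo_device) {v} 1"
  by (simp add: elects_leader_def verdict_after_def action_in_def solo_device_def)

lemma energy_le: "energy P S T v \<le> T"
proof -
  have "energy P S T v \<le> card {..<T}"
    unfolding energy_def by (intro card_mono) auto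
  then show ?thesis by simp
qed

lemma leader_election_for_parameters:
  fixes N :: nat and n' :: real and G :: nat
  assumes G: "G = 2 ^ 27"
  shows "\<exists>P. \<forall>n S. S \<subseteq> {1..N} \<and> card S = n \<and> n' / 2 < real n \<and> real n \<le> n' \<longrightarrow>
    (\<exists>T. elects_leader P S T \<and>
       real T \<le> (24 * G\<^sup>2 + 1) * (real n * log_ratio N n) \<and>
       (\<forall>v\<in>S. real (energy P S T v) \<le> (96 * G\<^sup>2 + 24 * G + 9) * log_ratio N n))"
proof -
  \<comment> \<open>An integral estimate: admissible \<open>n\<close> satisfy
    \<open>n \<le> K < 2 * n\<close>.\<close>
  define K where "K = nat \<lfloor>n'\<rfloor>"
  have size: "finite S" "0 < n" "n \<le> N" "n \<le> K" "K < 2 * n" "1 \<le> log_ratio N n"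
    if S: "S \<subseteq> {1..N} \<and> card S = n \<and> n' / 2 < real n \<and> real n \<le> n'" for n S
  proof -
    show "finite S" using S finite_subset by blast
    show "0 < n" using S by (cases n) auto
    show "n \<le> N" using S card_mono[of "{1..N}" S] by simp
    show "n \<le> K" using S by (simp add: K_def le_nat_floor)
    have "real K \<le> n'" using S by (simp add: K_def of_nat_floor)
    then show "K < 2 * n" using S by linarith
    show "1 \<le> log_ratio N n" using \<open>0 < n\<close> \<open>n \<le> N\<close> by (simp add: log_ratio_def)
  qed
  show ?thesis
  proof (cases "2 \<le> K \<and> K \<le> 2 * N")
    case K: True
    \<comment> \<open>Chosen for \<open>4 * N < K * 2 ^ d\<close>; as \<open>n \<le> K\<close>, it
      is at most \<open>log_ratio N n + 2\<close>.\<close>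
    define d where "d = nat \<lfloor>log 2 (4 * N / K)\<rfloor> + 1"
    have d_le: "real d \<le> 3 * log_ratio N n" if "0 < n" "n \<le> K" "1 \<le> log_ratio N n" for n
    proof -
      have pos: "0 < N" using K by simp
      have "0 \<le> log 2 (4 * N / K)" using K by simp
      then have "real d \<le> log 2 (4 * N / K) + 1" unfolding d_def by linarith
      also have "\<dots> \<le> log 2 (4 * N / n) + 1"
        using that K pos by (simp add: frac_le)
      also have "\<dots> = log_ratio N n + 2"
      proof -
        have "log 2 (4 * N / n) = log 2 4 + log 2 (N / n)"
          using that pos log_mult[of 2 4 "N / n"] by simp
        moreover have "log 2 (4::real) = 2" using log_pow_cancel[of 2 2] by simp
        ultimately show ?thesis by (simp add: log_ratio_def)
      qed
      also have "\<dots> \<le> 3 * log_ratio N n" using that by simp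
      finally show ?thesis .
    qed
    have "4 * N / K = 2 powr log 2 (4 * N / K)" using K by simp
    also have "\<dots> < 2 powr d" unfolding d_def by (intro powr_less_mono) linarith+
    also have "\<dots> = 2 ^ d" by (simp add: powr_realpow)
    finally have "real (4 * N) < real (K * 2 ^ d)" using K by (simp add: field_simps)
    then have d: "4 * N < K * 2 ^ d" by (simp only: of_nat_less_iff)
    obtain ts where ts: "\<forall>T\<in>set ts. fst T \<inter> snd T = {}" "length ts \<le> d * K * G\<^sup>2"
      "\<And>v. card {p. p < length ts \<and> v \<in> fst (ts ! p) \<union> snd (ts ! p)} \<le> 2 * d * G"
      "\<And>S. S \<subseteq> {1..N} \<Longrightarrow> card S \<le> K \<Longrightarrow> K < 2 * card S \<Longrightarrow>
         K \<le> 8 * card {u \<in> S. \<exists>p<length ts. tested ts S p u}"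
      using ex_tests[of K N d G] K d G by blast
    \<comment> \<open>At least \<open>K / 8\<close> devices pass a test, so their periods total at
      least \<open>c * K / 8\<close>, more than the at most \<open>d * K * G\<^sup>2\<close>
      tests.\<close>
    define c where "c = 8 * d * G\<^sup>2 + 1"
    show ?thesis
    proof (intro exI[of _ "queue_device ts c"] allI impI)
      fix n S
      assume S: "S \<subseteq> {1..N} \<and> card S = n \<and> n' / 2 < real n \<and> real n \<le> n'"
      note size = size[OF S]
      let ?L = "log_ratio N n" and ?T = "4 * length ts + 1"
      interpret queue ts c S
        using size ts(1) by unfold_locales (auto simp: c_def)
      let ?V = "{u \<in> S. \<exists>p<length ts. tested ts S p u}"
      have dL: "real d \<le> 3 * ?L" using size by (intro d_le)
      have "8 * length ts < 8 * d * G\<^sup>2 * K + K"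
        using ts(2) K by (simp add: ac_simps)
      also have "\<dots> = c * K" by (simp add: c_def)
      also have "\<dots> \<le> c * (8 * card ?V)"
        using ts(4)[of S] S size by (intro mult_left_mono) auto
      finally have "length ts < c * card ?V" by simp
      then have "elects_leader (queue_device ts c) S ?T" by (rule elects_leader_queue)
      moreover have "real ?T \<le> (24 * G\<^sup>2 + 1) * (n * ?L)"
      proof -
        have "real (length ts) \<le> real (d * K * G\<^sup>2)" using ts(2) by (simp only: of_nat_le_iff)
        also have "\<dots> \<le> (3 * ?L) * (2 * n) * G\<^sup>2"
          unfolding of_nat_mult using dL size by (intro mult_mono) auto
        finally have "4 * real (length ts) \<le> 24 * G\<^sup>2 * (n * ?L)" by (simp add: ac_simps)
        moreover have "1 * 1 \<le> n * ?L" using size by (intro mult_mono) auto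
        ultimately show ?thesis unfolding of_nat_add of_nat_1 distrib_right by linarith
      qed
      moreover have "real (energy (queue_device ts c) S ?T v) \<le> (96 * G\<^sup>2 + 24 * G + 9) * ?L"
        if "v \<in> S" for v
      proof -
        have "energy (queue_device ts c) S ?T v \<le> 4 * (2 * d * G + c + 1) + 1"
          using that ts(3) by (rule energy_queue_le)
        also have "\<dots> = d * (32 * G\<^sup>2 + 8 * G) + 9" by (simp add: c_def algebra_simps)
        finally have "real (energy (queue_device ts c) S ?T v) \<le> real (d * (32 * G\<^sup>2 + 8 * G) + 9)"
          by (simp only: of_nat_le_iff)
        also have "\<dots> = real d * real (32 * G\<^sup>2 + 8 * G) + 9" by simp
        also have "\<dots> \<le> (3 * ?L) * (32 * G\<^sup>2 + 8 * G) + 9 * ?L"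
          using dL size by (intro add_mono mult_right_mono) auto
        also have "\<dots> = (96 * G\<^sup>2 + 24 * G + 9) * ?L" by (simp add: algebra_simps)
        finally show ?thesis .
      qed
      ultimately show "\<exists>T. elects_leader (queue_device ts c) S T \<and>
          real T \<le> (24 * G\<^sup>2 + 1) * (real n * ?L) \<and>
          (\<forall>v\<in>S. real (energy (queue_device ts c) S T v) \<le> (96 * G\<^sup>2 + 24 * G + 9) * ?L)"
        by blast
    qed
  next
    case False
    show ?thesis
    proof (intro exI[of _ "\<lambda>_. solo_device"] allI impI)
      fix n S
      assume S: "S \<subseteq> {1..N} \<and> card S = n \<and> n' / 2 < real n \<and> real n \<le> n'"
      note size = size[OF S]
      \<comment> \<open>Here \<open>K < 2 * n \<le> 2 * N\<close>, so what fails is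
        \<open>2 \<le> K\<close>, and \<open>n \<le> K\<close> leaves a single device.\<close>
      then have "n = 1" using False by linarith
      then obtain v where v: "S = {v}" using S card_1_singletonE by metis
      have "1 * 1 \<le> real (24 * G\<^sup>2 + 1) * log_ratio N n"
        "1 * 1 \<le> real (96 * G\<^sup>2 + 24 * G + 9) * log_ratio N n"
        using size by (intro mult_mono; simp)+
      moreover have "real (energy (\<lambda>_. solo_device) S 1 v) \<le> 1"
        using energy_le[of _ S 1] by simp
      ultimately show "\<exists>T. elects_leader (\<lambda>_. solo_device) S T \<and>
          real T \<le> (24 * G\<^sup>2 + 1) * (real n * log_ratio N n) \<and>
          (\<forall>v\<in>S. real (energy (\<lambda>_. solo_device) S T v)
             \<le> (96 * G\<^sup>2 + 24 * G + 9) * log_ratio N n)"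
        unfolding v using elects_leader_solo \<open>n = 1\<close> by (intro exI[of _ 1]) auto
    qed
  qed
qed

theorem theorem1p3:
  "\<exists>(A :: algorithm) (C\<^sub>T :: real) (C\<^sub>E :: real). C\<^sub>T > 0 \<and> C\<^sub>E > 0 \<and>
     (\<forall>(N :: nat) (n' :: real) (n :: nat) (S :: nat set).
        S \<subseteq> {1..N} \<and> card S = n \<and> n' / 2 < real n \<and> real n \<le> n' \<longrightarrow>
        (\<exists>T. elects_leader (A N n') S T \<and>
             real T \<le> C\<^sub>T * (real n * log_ratio N n) \<and>
             (\<forall>v\<in>S. real (energy (A N n') S T v) \<le> C\<^sub>E * log_ratio N n)))"
proof -
  obtain G :: nat where G: "G = 2 ^ 27" by blast
  let ?Q = "\<lambda>N n' P. \<forall>n S. S \<subseteq> {1..N} \<and> card S = n \<and> n' / 2 < real n \<and> real n \<le> n' \<longrightarrow>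
    (\<exists>T. elects_leader P S T \<and>
       real T \<le> (24 * G\<^sup>2 + 1) * (real n * log_ratio N n) \<and>
       (\<forall>v\<in>S. real (energy P S T v) \<le> (96 * G\<^sup>2 + 24 * G + 9) * log_ratio N n))"
  have "\<forall>N n'. \<exists>P. ?Q N n' P"
    using leader_election_for_parameters[OF G] by (intro allI)
  then have "\<exists>A. \<forall>N n'. ?Q N n' (A N n')"
    by (simp only: choice_iff)
  then obtain A :: algorithm where A: "\<forall>N n'. ?Q N n' (A N n')" ..
  moreover have "0 < real (24 * G\<^sup>2 + 1)" "0 < real (96 * G\<^sup>2 + 24 * G + 9)"
    by (subst of_nat_0_less_iff, simp)+
  ultimately show ?thesis by blast
qed

end
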